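(* Let $A\in\mathbb{R}^{n\times n}$ be symmetric positive definite, let $u<u_\ell$ be the unit roundoffs of the working and low precisions, and let $\widetilde Q\in\mathbb{R}^{n\times n}$ satisfy $\|\widetilde Q^T\widetilde Q-I\|_2\le p_1u<1$ and $\mathrm{off}(\widetilde A)\le p_4u_\ell\|A\|_F$, where $\widetilde A=(\widetilde a_{ij})=\widetilde Q^TA\widetilde Q$. Then $$\frac{\mathrm{off}(\widetilde A)}{\min_i\widetilde a_{ii}}\le\frac{p_4u_\ell\|A\|_F}{\lambda_n(\widetilde A)}\le p_{18}\,u_\ell\,\kappa_2(A),\qquad p_{18}=\frac{n^{1/2}p_4}{1-p_1u}.$$ Consequently, if $\kappa_2(A)<1/(p_{18}u_\ell)$, then $\theta:=\mathrm{off}(\widetilde A)/\min_i\widetilde a_{ii}<1$ and $\kappa_2^S(\widetilde A)\le(1+\theta)/(1-\theta)$.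
   Context: $p_1,p_4$ are positive quantities depending only on $n$ (low-degree polynomials in $n$). $\mathrm{off}(B)=\bigl(\sum_{i\ne j}b_{ij}^2\bigr)^{1/2}$. $\lambda_n(B)$ is the smallest and $\lambda_1(B)$ the largest eigenvalue of a symmetric $B$. For symmetric positive definite $B$, $\kappa_2(B)=\lambda_1(B)/\lambda_n(B)$ and $\kappa_2^S(B)=\kappa_2(DBD)$ with $D=\mathrm{diag}(b_{ii}^{-1/2})$. *)

theory Defs
  imports "HOL-Analysis.Analysis"
begin

definition sym_pos_def :: "real^'n^'n \<Rightarrow> bool" where
  "sym_pos_def A \<longleftrightarrow> transpose A = A \<and> (\<forall>x. x \<noteq> 0 \<longrightarrow> x \<bullet> (A *v x) > 0)"

definition eigenvalues :: "real^'n^'n \<Rightarrow> real set" where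
  "eigenvalues B = {l. \<exists>v. v \<noteq> 0 \<and> B *v v = l *\<^sub>R v}"

(* lambda_max and lambda_min are meant for symmetric B only, where the set of real
   eigenvalues is finite and nonempty. *)

definition lambda_max :: "real^'n^'n \<Rightarrow> real" where
  "lambda_max B = Max (eigenvalues B)"

definition lambda_min :: "real^'n^'n \<Rightarrow> real" where
  "lambda_min B = Min (eigenvalues B)"

definition norm2 :: "real^'n^'n \<Rightarrow> real" where
  "norm2 B = onorm (\<lambda>x. B *v x)"

definition frob_norm :: "real^'n^'n \<Rightarrow> real" where
  "frob_norm B = sqrt (\<Sum>i\<in>UNIV. \<Sum>j\<in>UNIV. (B $ i $ j)\<^sup>2)"

lemma frob_norm_eq_norm: "frob_norm B = norm B"
  by (simp add: frob_norm_def norm_vec_def L2_set_def sum_nonneg)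

definition off :: "real^'n^'n \<Rightarrow> real" where
  "off B = sqrt (\<Sum>(i, j) \<in> {(i, j). i \<noteq> j}. (B $ i $ j)\<^sup>2)"

definition min_diag :: "real^'n^'n \<Rightarrow> real" where
  "min_diag B = Min (range (\<lambda>i. B $ i $ i))"

(* kappa2 and kappa2_S are meant for symmetric positive definite B only. *)

definition kappa2 :: "real^'n^'n \<Rightarrow> real" where
  "kappa2 B = lambda_max B / lambda_min B"

definition diag_scaling :: "real^'n^'n \<Rightarrow> real^'n^'n" where
  "diag_scaling B = (\<chi> i j. if i = j then (B $ i $ i) powr (- 1 / 2) else 0)"

definition kappa2_S :: "real^'n^'n \<Rightarrow> real" where
  "kappa2_S B = kappa2 (diag_scaling B ** B ** diag_scaling B)"

end

theory Submission
  imports Defs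
begin

text \<open>Everything reduces to the quadratic form \<open>x \<bullet> (B *v x)\<close>. For symmetric \<open>B\<close> its extreme
  values on the unit sphere are the extreme eigenvalues (\<open>lambda_min_bound\<close>, \<open>lambda_max_bound\<close>),
  so spectral estimates are estimates of that form. The near-orthogonality of \<open>Q\<close> implies
  \<open>(1 - e) * (norm x)\<^sup>2 \<le> (norm (Q *v x))\<^sup>2\<close> for \<open>e = p1 n * u\<close>, and since the form of
  \<open>transpose Q ** A ** Q\<close> at \<open>x\<close> is the form of \<open>A\<close> at \<open>Q *v x\<close>, the smallest eigenvalue
  shrinks at worst by the factor \<open>1 - e\<close> (\<open>lambda_min_congruence\<close>). The diagonal entries are
  values of the form at unit vectors, so they are at least the smallest eigenvalue; with the
  assumed bound on the off-diagonal part this is the first inequality. The second adds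
  \<open>frob_norm A \<le> sqrt n * lambda_max A\<close> (\<open>frob_norm_le_lambda_max\<close>), which holds because every
  column of a positive semidefinite \<open>A\<close> has length at most \<open>lambda_max A\<close>.

  For the scaled condition number, scaling to unit diagonal divides the entry at \<open>(i, j)\<close> by the
  geometric mean of two diagonal entries, hence by at least the smallest one. The scaled matrix is
  thus the identity plus a matrix of Frobenius norm at most \<open>\<theta>\<close>, and its spectrum lies in the
  interval from \<open>1 - \<theta>\<close> to \<open>1 + \<theta>\<close> (\<open>kappa2_S_le\<close>).\<close>

section \<open>Symmetric matrices and Rayleigh quotients\<close>

lemma inner_matrix_transpose:
  fixes A :: "real^'n^'n"
  shows "x \<bullet> (transpose A *v y) = (A *v x) \<bullet> y"
  by (metis dot_lmul_matrix inner_commute transpose_matrix_vector)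

lemma inner_symmetric_matrix:
  fixes A :: "real^'n^'n"
  assumes "transpose A = A"
  shows "x \<bullet> (A *v y) = (A *v x) \<bullet> y"
  using inner_matrix_transpose[of x A y] assms by simp

text \<open>The form \<open>(x, y) \<mapsto> x \<bullet> (A *v y)\<close> of a positive semidefinite matrix is an inner product up to
  definiteness, and the discriminant argument does not use definiteness: where \<open>x\<close> is
  isotropic, the quadratic polynomial is affine, and being bounded below makes it constant.\<close>

lemma psd_Cauchy_Schwarz:
  fixes A :: "real^'n^'n"
  assumes sym: "transpose A = A" and psd: "\<And>x. 0 \<le> x \<bullet> (A *v x)"
  shows "(x \<bullet> (A *v y))\<^sup>2 \<le> (x \<bullet> (A *v x)) * (y \<bullet> (A *v y))"
proof -
  define a b c where "a = x \<bullet> (A *v x)" and "b = x \<bullet> (A *v y)" and "c = y \<bullet> (A *v y)"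
  have b': "y \<bullet> (A *v x) = b"
    using inner_symmetric_matrix[OF sym, of y x] by (simp add: b_def inner_commute)
  have pos: "0 \<le> t\<^sup>2 * a + 2 * t * b + c" for t
  proof -
    have "(t *\<^sub>R x + y) \<bullet> (A *v (t *\<^sub>R x + y)) = t\<^sup>2 * a + 2 * t * b + c"
      using b' by (simp add: matrix_vector_right_distrib matrix_vector_mult_scaleR inner_add_left
          inner_add_right a_def b_def c_def power2_eq_square algebra_simps)
    then show ?thesis using psd by metis
  qed
  have "b\<^sup>2 \<le> a * c"
  proof (cases "a = 0")
    case True
    have "b = 0"
    proof (rule ccontr)
      assume "b \<noteq> 0"
      then show False using pos[of "- (c + 1) / (2 * b)"] True by (simp add: field_simps)
    qed
    then show ?thesis using True by simp
  next
    case False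
    then have "a > 0" using psd[of x] by (simp add: a_def less_le)
    then show ?thesis
      using pos[of "- b / a"] by (simp add: field_simps power2_eq_square)
  qed
  then show ?thesis by (simp add: a_def b_def c_def)
qed

lemma psd_isotropic_imp_kernel:
  fixes A :: "real^'n^'n"
  assumes "transpose A = A" "\<And>x. 0 \<le> x \<bullet> (A *v x)" "x \<bullet> (A *v x) = 0"
  shows "A *v x = 0"
  using psd_Cauchy_Schwarz[OF assms(1,2), of "A *v x" x] assms(3) by simp

lemma eigenvalue_inner:
  assumes "l \<in> eigenvalues B"
  obtains v where "v \<noteq> 0" "v \<bullet> (B *v v) = l * (norm v)\<^sup>2"
  using assms by (auto simp: eigenvalues_def power2_norm_eq_inner)

text \<open>Eigenvectors for distinct eigenvalues are orthogonal, and a space of finite dimension has no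
  infinite set of pairwise orthogonal nonzero vectors.\<close>

lemma finite_eigenvalues_symmetric:
  fixes B :: "real^'n^'n"
  assumes sym: "transpose B = B"
  shows "finite (eigenvalues B)"
proof -
  have "\<forall>l\<in>eigenvalues B. \<exists>v. v \<noteq> 0 \<and> B *v v = l *\<^sub>R v"
    by (simp add: eigenvalues_def)
  then obtain f where f: "\<And>l. l \<in> eigenvalues B \<Longrightarrow> f l \<noteq> 0 \<and> B *v f l = l *\<^sub>R f l"
    by metis
  have orth: "orthogonal (f l) (f m)"
    if "l \<in> eigenvalues B" "m \<in> eigenvalues B" "l \<noteq> m" for l m
    using inner_symmetric_matrix[OF sym, of "f l" "f m"] f[OF that(1)] f[OF that(2)] that(3)
    by (simp add: orthogonal_def)
  have "inj_on f (eigenvalues B)"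
    using orth f by (metis inj_onI orthogonal_self)
  moreover have "finite (f ` eigenvalues B)"
    by (rule pairwise_orthogonal_imp_finite) (auto simp: pairwise_def intro!: orth)
  ultimately show ?thesis by (rule finite_imageD[rotated])
qed

text \<open>With \<open>m\<close> the minimum of the Rayleigh quotient, attained at \<open>v\<close>, the matrix \<open>B - m I\<close> is
  positive semidefinite and \<open>v\<close> is isotropic for it, hence in its kernel: \<open>v\<close> is an
  eigenvector.\<close>

lemma Rayleigh_minimum:
  fixes B :: "real^'n^'n"
  assumes sym: "transpose B = B"
  obtains m where "m \<in> eigenvalues B" "\<And>x. m * (norm x)\<^sup>2 \<le> x \<bullet> (B *v x)"
proof -
  have "continuous_on (sphere 0 1) (\<lambda>x. x \<bullet> (B *v x))"
    by (intro continuous_intros linear_continuous_on linear_linear[THEN iffD2]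
        matrix_vector_mul_linear)
  moreover obtain i :: 'n where True by simp
  have "axis i 1 \<in> (sphere 0 1 :: (real^'n) set)" by (simp add: norm_axis_1)
  then have "(sphere 0 1 :: (real^'n) set) \<noteq> {}" by blast
  ultimately obtain v where v: "norm v = 1"
      "\<And>x. norm x = 1 \<Longrightarrow> v \<bullet> (B *v v) \<le> x \<bullet> (B *v x)"
    using continuous_attains_inf[of "sphere 0 1" "\<lambda>x. x \<bullet> (B *v x)"] by auto
  define m where "m = v \<bullet> (B *v v)"
  have bound: "m * (norm x)\<^sup>2 \<le> x \<bullet> (B *v x)" for x
  proof (cases "x = 0")
    case False
    have "m \<le> (x /\<^sub>R norm x) \<bullet> (B *v (x /\<^sub>R norm x))"
      unfolding m_def by (rule v(2)) (use False in simp)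
    also have "\<dots> = (x \<bullet> (B *v x)) / (norm x)\<^sup>2"
      by (simp add: matrix_vector_mult_scaleR power2_eq_square field_simps)
    finally show ?thesis using False by (simp add: field_simps)
  qed simp
  define C where "C = B - mat m"
  have C: "C *v x = B *v x - m *\<^sub>R x" for x
    by (simp add: C_def matrix_vector_mult_diff_rdistrib)
      (simp add: vec_eq_iff matrix_vector_mult_def mat_def if_distrib[of "\<lambda>t. t * _"] cong: if_cong)
  have "C *v v = 0"
  proof (rule psd_isotropic_imp_kernel)
    show "transpose C = C"
      using sym by (simp add: C_def transpose_def mat_def vec_eq_iff)
    show "0 \<le> x \<bullet> (C *v x)" for x
      using bound[of x] by (simp add: C inner_diff_right power2_norm_eq_inner)
    show "v \<bullet> (C *v v) = 0"
      using v(1) by (simp add: C inner_diff_right m_def flip: power2_norm_eq_inner)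
  qed
  moreover have "v \<noteq> 0" using v(1) by auto
  ultimately have "m \<in> eigenvalues B" by (auto simp: eigenvalues_def C)
  then show ?thesis using bound that by blast
qed

lemma uminus_matrix_vector:
  fixes B :: "real^'n^'n"
  shows "(- B) *v x = - (B *v x)"
  by (simp add: vec_eq_iff matrix_vector_mult_def sum_negf)

lemma Rayleigh_maximum:
  fixes B :: "real^'n^'n"
  assumes sym: "transpose B = B"
  obtains m where "m \<in> eigenvalues B" "\<And>x. x \<bullet> (B *v x) \<le> m * (norm x)\<^sup>2"
proof -
  have "transpose (- B) = - B" using sym by (simp add: transpose_def vec_eq_iff)
  then obtain m where m: "m \<in> eigenvalues (- B)" "\<And>x. m * (norm x)\<^sup>2 \<le> x \<bullet> ((- B) *v x)"
    using Rayleigh_minimum by blast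
  show ?thesis
  proof (rule that[of "- m"])
    show "- m \<in> eigenvalues B"
      using m(1) by (auto simp: eigenvalues_def uminus_matrix_vector) (metis minus_equation_iff)
    show "x \<bullet> (B *v x) \<le> - m * (norm x)\<^sup>2" for x
      using m(2)[of x] by (simp add: uminus_matrix_vector)
  qed
qed

lemma lambda_min_eigenvalue:
  fixes B :: "real^'n^'n"
  assumes "transpose B = B"
  shows "lambda_min B \<in> eigenvalues B"
  unfolding lambda_min_def
  by (rule Min_in[OF finite_eigenvalues_symmetric[OF assms]])
    (use Rayleigh_minimum[OF assms] in blast)

lemma lambda_max_eigenvalue:
  fixes B :: "real^'n^'n"
  assumes "transpose B = B"
  shows "lambda_max B \<in> eigenvalues B"
  unfolding lambda_max_def
  by (rule Max_in[OF finite_eigenvalues_symmetric[OF assms]])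
    (use Rayleigh_minimum[OF assms] in blast)

lemma lambda_min_bound:
  fixes B :: "real^'n^'n"
  assumes sym: "transpose B = B"
  shows "lambda_min B * (norm x)\<^sup>2 \<le> x \<bullet> (B *v x)"
proof -
  obtain m where m: "m \<in> eigenvalues B" "\<And>x. m * (norm x)\<^sup>2 \<le> x \<bullet> (B *v x)"
    using Rayleigh_minimum[OF sym] by blast
  have "lambda_min B \<le> m"
    unfolding lambda_min_def using finite_eigenvalues_symmetric[OF sym] m(1) by (rule Min_le)
  then show ?thesis using m(2)[of x] mult_right_mono[of "lambda_min B" m "(norm x)\<^sup>2"] by simp
qed

lemma lambda_max_bound:
  fixes B :: "real^'n^'n"
  assumes sym: "transpose B = B"
  shows "x \<bullet> (B *v x) \<le> lambda_max B * (norm x)\<^sup>2"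
proof -
  obtain m where m: "m \<in> eigenvalues B" "\<And>x. x \<bullet> (B *v x) \<le> m * (norm x)\<^sup>2"
    using Rayleigh_maximum[OF sym] by blast
  have "m \<le> lambda_max B"
    unfolding lambda_max_def using finite_eigenvalues_symmetric[OF sym] m(1) by (rule Max_ge)
  then show ?thesis using m(2)[of x] mult_right_mono[of m "lambda_max B" "(norm x)\<^sup>2"] by simp
qed

lemma lambda_min_greatest:
  fixes B :: "real^'n^'n"
  assumes sym: "transpose B = B" and bound: "\<And>x. c * (norm x)\<^sup>2 \<le> x \<bullet> (B *v x)"
  shows "c \<le> lambda_min B"
proof -
  obtain v where "v \<noteq> 0" "v \<bullet> (B *v v) = lambda_min B * (norm v)\<^sup>2"
    using eigenvalue_inner[OF lambda_min_eigenvalue[OF sym]] .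
  then show ?thesis using bound[of v] by simp
qed

lemma lambda_max_least:
  fixes B :: "real^'n^'n"
  assumes sym: "transpose B = B" and bound: "\<And>x. x \<bullet> (B *v x) \<le> c * (norm x)\<^sup>2"
  shows "lambda_max B \<le> c"
proof -
  obtain v where "v \<noteq> 0" "v \<bullet> (B *v v) = lambda_max B * (norm v)\<^sup>2"
    using eigenvalue_inner[OF lambda_max_eigenvalue[OF sym]] .
  then show ?thesis using bound[of v] by simp
qed

lemma lambda_min_pos:
  assumes "sym_pos_def B"
  shows "0 < lambda_min B"
proof -
  have "transpose B = B" using assms by (simp add: sym_pos_def_def)
  then obtain v where v: "v \<noteq> 0" "v \<bullet> (B *v v) = lambda_min B * (norm v)\<^sup>2"
    using eigenvalue_inner[OF lambda_min_eigenvalue] by blast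
  then have "0 < v \<bullet> (B *v v)" using assms by (metis sym_pos_def_def)
  then show ?thesis using v by (simp add: zero_less_mult_iff)
qed

lemma lambda_min_le_lambda_max:
  fixes B :: "real^'n^'n"
  assumes "transpose B = B"
  shows "lambda_min B \<le> lambda_max B"
  using finite_eigenvalues_symmetric[OF assms] lambda_min_eigenvalue[OF assms]
  by (simp add: lambda_max_def)

lemma lambda_min_le_diag:
  fixes B :: "real^'n^'n"
  assumes "transpose B = B"
  shows "lambda_min B \<le> B $ i $ i"
  using lambda_min_bound[OF assms, of "axis i 1"]
  by (simp add: norm_axis_1 inner_axis' matrix_vector_mult_basis column_def)

section \<open>The Frobenius norm\<close>

text \<open>By the Cauchy-Schwarz inequality for the form of \<open>A\<close> at the vectors \<open>y = A *v x\<close> and \<open>x\<close>,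
  \<open>(norm y)^4\<close> is at most \<open>lambda_max A * (norm y)\<^sup>2 * (lambda_max A * (norm x)\<^sup>2)\<close>.\<close>

lemma norm_psd_matrix_vector_le:
  fixes A :: "real^'n^'n"
  assumes sym: "transpose A = A" and psd: "\<And>x. 0 \<le> x \<bullet> (A *v x)"
  shows "(norm (A *v x))\<^sup>2 \<le> (lambda_max A)\<^sup>2 * (norm x)\<^sup>2"
proof (cases "A *v x = 0")
  case False
  let ?y = "A *v x"
  have L: "0 \<le> lambda_max A"
  proof -
    have "0 \<le> lambda_max A * (norm ?y)\<^sup>2"
      using psd[of ?y] lambda_max_bound[OF sym, of ?y] by linarith
    then show ?thesis using False by (auto simp: zero_le_mult_iff)
  qed
  have "((norm ?y)\<^sup>2)\<^sup>2 = (?y \<bullet> (A *v x))\<^sup>2" by (simp add: power2_norm_eq_inner)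
  also have "\<dots> \<le> (?y \<bullet> (A *v ?y)) * (x \<bullet> (A *v x))"
    by (rule psd_Cauchy_Schwarz[OF sym psd])
  also have "\<dots> \<le> (lambda_max A * (norm ?y)\<^sup>2) * (lambda_max A * (norm x)\<^sup>2)"
    by (intro mult_mono lambda_max_bound[OF sym] psd mult_nonneg_nonneg L zero_le_power2)
  finally have "(norm ?y)\<^sup>2 * (norm ?y)\<^sup>2 \<le> (norm ?y)\<^sup>2 * ((lambda_max A)\<^sup>2 * (norm x)\<^sup>2)"
    by (simp add: power2_eq_square algebra_simps)
  then show ?thesis
    using False by (simp only: mult_le_cancel_left_pos zero_less_power2 norm_eq_zero not_False_eq_True)
qed simp

lemma frob_norm_le_lambda_max:
  fixes A :: "real^'n^'n"
  assumes spd: "sym_pos_def A"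
  shows "frob_norm A \<le> sqrt (real CARD('n)) * lambda_max A"
proof -
  have sym: "transpose A = A" using spd by (simp add: sym_pos_def_def)
  have psd: "0 \<le> x \<bullet> (A *v x)" for x
    using spd by (cases "x = 0") (auto simp: sym_pos_def_def less_imp_le)
  have L: "0 \<le> lambda_max A"
    using lambda_min_pos[OF spd] lambda_min_le_lambda_max[OF sym] by simp
  have "(\<Sum>i\<in>UNIV. \<Sum>j\<in>UNIV. (A $ i $ j)\<^sup>2) = (\<Sum>j\<in>UNIV. \<Sum>i\<in>UNIV. (A $ i $ j)\<^sup>2)"
    by (rule sum.swap)
  also have "\<dots> = (\<Sum>j\<in>UNIV. (norm (A *v axis j 1))\<^sup>2)"
    by (simp add: matrix_vector_mult_basis column_def norm_vec_def L2_set_def sum_nonneg)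
  also have "\<dots> \<le> (\<Sum>j\<in>(UNIV :: 'n set). (lambda_max A)\<^sup>2)"
    using norm_psd_matrix_vector_le[OF sym psd, of "axis _ 1"] by (intro sum_mono) (simp add: norm_axis_1)
  finally have "frob_norm A \<le> sqrt (real CARD('n) * (lambda_max A)\<^sup>2)"
    by (simp add: frob_norm_def)
  then show ?thesis using L by (simp add: real_sqrt_mult)
qed

lemma norm_matrix_vector_le_frob_norm:
  fixes N :: "real^'n^'n"
  shows "norm (N *v x) \<le> frob_norm N * norm x"
proof (rule power2_le_imp_le)
  have "(norm (N *v x))\<^sup>2 = (\<Sum>i\<in>UNIV. (N $ i \<bullet> x)\<^sup>2)"
    by (simp add: norm_vec_def L2_set_def sum_nonneg matrix_vector_mul_component)
  also have "\<dots> \<le> (\<Sum>i\<in>UNIV. (norm (N $ i))\<^sup>2 * (norm x)\<^sup>2)"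
    by (intro sum_mono) (metis Cauchy_Schwarz_ineq power2_norm_eq_inner)
  also have "\<dots> = (frob_norm N * norm x)\<^sup>2"
    by (simp add: frob_norm_eq_norm norm_vec_def[of N] L2_set_def sum_nonneg power_mult_distrib
        sum_distrib_right)
  finally show "(norm (N *v x))\<^sup>2 \<le> (frob_norm N * norm x)\<^sup>2" .
qed (simp add: frob_norm_eq_norm)

lemma off_eq_sum: "off B = sqrt (\<Sum>i\<in>UNIV. \<Sum>j\<in>UNIV. if i = j then 0 else (B $ i $ j)\<^sup>2)"
proof -
  have "(\<Sum>(i, j) \<in> {(i, j). i \<noteq> j}. (B $ i $ j)\<^sup>2)
      = (\<Sum>(i, j)\<in>UNIV. if i = j then 0 else (B $ i $ j)\<^sup>2)"
    by (rule sum.mono_neutral_cong_left) auto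
  then show ?thesis by (simp add: off_def sum.cartesian_product)
qed

lemma off_nonneg: "0 \<le> off B"
  unfolding off_def by (intro real_sqrt_ge_zero sum_nonneg) auto

section \<open>Congruence by a nearly orthogonal matrix\<close>

text \<open>The form of \<open>transpose Q ** Q - I\<close> at \<open>x\<close> is \<open>(norm (Q *v x))\<^sup>2 - (norm x)\<^sup>2\<close>, so its
  operator norm bounds the relative change of squared lengths under \<open>Q\<close>.\<close>

lemma nearly_orthogonal_norm_ge:
  fixes Q :: "real^'n^'n"
  assumes "norm2 (transpose Q ** Q - mat 1) \<le> e"
  shows "(1 - e) * (norm x)\<^sup>2 \<le> (norm (Q *v x))\<^sup>2"
proof -
  let ?N = "transpose Q ** Q - mat 1"
  have N: "x \<bullet> (?N *v x) = (norm (Q *v x))\<^sup>2 - (norm x)\<^sup>2"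
    by (simp add: matrix_vector_mult_diff_rdistrib inner_diff_right inner_matrix_transpose
        power2_norm_eq_inner del: transpose_matrix_vector flip: matrix_vector_mul_assoc)
  have "\<bar>x \<bullet> (?N *v x)\<bar> \<le> norm x * norm (?N *v x)" by (rule Cauchy_Schwarz_ineq2)
  also have "norm (?N *v x) \<le> norm2 ?N * norm x"
    unfolding norm2_def by (rule onorm[OF matrix_vector_mul_bounded_linear])
  also have "\<dots> \<le> e * norm x" by (rule mult_right_mono[OF assms norm_ge_zero])
  finally have "\<bar>(norm (Q *v x))\<^sup>2 - (norm x)\<^sup>2\<bar> \<le> norm x * (e * norm x)"
    unfolding N by (simp add: mult_left_mono)
  then show ?thesis by (simp add: power2_eq_square algebra_simps)
qed

lemma congruence_inner:
  fixes A Q :: "real^'n^'n"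
  shows "x \<bullet> ((transpose Q ** A ** Q) *v x) = (Q *v x) \<bullet> (A *v (Q *v x))"
  by (simp add: inner_matrix_transpose del: transpose_matrix_vector flip: matrix_vector_mul_assoc)

lemma sym_pos_def_congruence:
  fixes A Q :: "real^'n^'n"
  assumes spd: "sym_pos_def A" and inj: "\<And>x. x \<noteq> 0 \<Longrightarrow> Q *v x \<noteq> 0"
  shows "sym_pos_def (transpose Q ** A ** Q)"
proof -
  have "transpose A = A" using spd by (simp add: sym_pos_def_def)
  then have "transpose (transpose Q ** A ** Q) = transpose Q ** A ** Q"
    by (simp add: matrix_transpose_mul transpose_transpose matrix_mul_assoc)
  moreover have "0 < x \<bullet> ((transpose Q ** A ** Q) *v x)" if "x \<noteq> 0" for x
    using spd inj[OF that] unfolding congruence_inner sym_pos_def_def by blast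
  ultimately show ?thesis unfolding sym_pos_def_def by blast
qed

lemma lambda_min_congruence:
  fixes A Q :: "real^'n^'n"
  assumes spd: "sym_pos_def A" and Q: "\<And>x. c * (norm x)\<^sup>2 \<le> (norm (Q *v x))\<^sup>2"
  shows "c * lambda_min A \<le> lambda_min (transpose Q ** A ** Q)"
proof (rule lambda_min_greatest)
  have sym: "transpose A = A" using spd by (simp add: sym_pos_def_def)
  then show "transpose (transpose Q ** A ** Q) = transpose Q ** A ** Q"
    by (simp add: matrix_transpose_mul transpose_transpose matrix_mul_assoc)
  fix x
  have "lambda_min A * (c * (norm x)\<^sup>2) \<le> lambda_min A * (norm (Q *v x))\<^sup>2"
    by (rule mult_left_mono[OF Q]) (simp add: lambda_min_pos[OF spd] less_imp_le)
  also have "\<dots> \<le> (Q *v x) \<bullet> (A *v (Q *v x))" by (rule lambda_min_bound[OF sym])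
  finally show "c * lambda_min A * (norm x)\<^sup>2 \<le> x \<bullet> ((transpose Q ** A ** Q) *v x)"
    by (simp add: congruence_inner mult_ac)
qed

section \<open>Scaling to unit diagonal\<close>

lemma diag_scaling_nth:
  fixes B :: "real^'n^'n"
  shows "(diag_scaling B ** B ** diag_scaling B) $ i $ j
    = (B $ i $ i) powr (- 1 / 2) * B $ i $ j * (B $ j $ j) powr (- 1 / 2)"
  by (simp add: diag_scaling_def matrix_matrix_mult_def if_distrib[of "\<lambda>t. t * _"]
      if_distrib[of "\<lambda>t. _ * t"] cong: if_cong)

lemma powr_minus_half:
  fixes b :: real
  assumes "0 < b"
  shows "b powr (- 1 / 2) = 1 / sqrt b"
  using powr_minus[of b "1/2"] assms by (simp add: powr_half_sqrt inverse_eq_divide)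

lemma kappa2_S_le:
  fixes B :: "real^'n^'n"
  assumes sym: "transpose B = B" and d: "0 < min_diag B" and \<theta>: "off B / min_diag B < 1"
  shows "kappa2_S B \<le> (1 + off B / min_diag B) / (1 - off B / min_diag B)"
proof -
  define \<theta> where "\<theta> = off B / min_diag B"
  define H where "H = diag_scaling B ** B ** diag_scaling B"
  define N where "N = H - mat 1"
  let ?d = "min_diag B"
  have le: "?d \<le> B $ i $ i" for i by (simp add: min_diag_def)
  have pos: "0 < B $ i $ i" for i using d le[of i] by simp
  have symB: "B $ i $ j = B $ j $ i" for i j
    using arg_cong[OF sym, of "\<lambda>M. M $ j $ i"] by (simp add: transpose_def)
  have H: "H $ i $ j = B $ i $ j / (sqrt (B $ i $ i) * sqrt (B $ j $ j))" for i j
    unfolding H_def diag_scaling_nth powr_minus_half[OF pos] by simp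
  have symH: "transpose H = H"
    by (simp add: vec_eq_iff transpose_def H symB mult.commute)
  have diag: "H $ i $ i = 1" for i using pos[of i] by (simp add: H)
  have entry: "(N $ i $ j)\<^sup>2 \<le> (if i = j then 0 else (B $ i $ j)\<^sup>2) / ?d\<^sup>2" for i j
  proof (cases "i = j")
    case False
    have "?d\<^sup>2 \<le> B $ i $ i * B $ j $ j"
      using le[of i] le[of j] d by (auto simp: power2_eq_square intro: mult_mono)
    moreover have "(N $ i $ j)\<^sup>2 = (B $ i $ j)\<^sup>2 / (B $ i $ i * B $ j $ j)"
      using False pos[of i] pos[of j]
      by (simp add: N_def mat_def H power_divide power_mult_distrib)
    ultimately show ?thesis using False d by (simp add: frac_le)
  qed (simp add: N_def mat_def diag)
  have "frob_norm N \<le> \<theta>"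
  proof -
    have "frob_norm N \<le> sqrt ((\<Sum>i\<in>UNIV. \<Sum>j\<in>UNIV. if i = j then 0 else (B $ i $ j)\<^sup>2) / ?d\<^sup>2)"
      unfolding frob_norm_def sum_divide_distrib
      by (intro real_sqrt_le_mono sum_mono entry)
    also have "\<dots> = \<theta>" using d by (simp add: \<theta>_def off_eq_sum real_sqrt_divide)
    finally show ?thesis .
  qed
  have form: "\<bar>x \<bullet> (H *v x) - (norm x)\<^sup>2\<bar> \<le> \<theta> * (norm x)\<^sup>2" for x
  proof -
    have "x \<bullet> (H *v x) - (norm x)\<^sup>2 = x \<bullet> (N *v x)"
      by (simp add: N_def matrix_vector_mult_diff_rdistrib inner_diff_right power2_norm_eq_inner)
    also have "\<bar>\<dots>\<bar> \<le> norm x * norm (N *v x)" by (rule Cauchy_Schwarz_ineq2)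
    also have "\<dots> \<le> norm x * (frob_norm N * norm x)"
      by (rule mult_left_mono[OF norm_matrix_vector_le_frob_norm norm_ge_zero])
    also have "\<dots> \<le> norm x * (\<theta> * norm x)"
      by (intro mult_left_mono mult_right_mono \<open>frob_norm N \<le> \<theta>\<close>) auto
    finally show ?thesis by (simp add: power2_eq_square mult_ac)
  qed
  have lo: "1 - \<theta> \<le> lambda_min H"
  proof (rule lambda_min_greatest[OF symH])
    show "(1 - \<theta>) * (norm x)\<^sup>2 \<le> x \<bullet> (H *v x)" for x
      using form[of x] by (simp add: left_diff_distrib)
  qed
  have hi: "lambda_max H \<le> 1 + \<theta>"
  proof (rule lambda_max_least[OF symH])
    show "x \<bullet> (H *v x) \<le> (1 + \<theta>) * (norm x)\<^sup>2" for x
      using form[of x] by (simp add: distrib_right)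
  qed
  have \<theta>1: "0 \<le> \<theta>" "\<theta> < 1" using \<theta> d off_nonneg[of B] by (auto simp: \<theta>_def)
  have "lambda_max H / lambda_min H \<le> (1 + \<theta>) / (1 - \<theta>)"
    using lo hi \<theta>1 by (intro frac_le) auto
  then show ?thesis by (simp add: kappa2_S_def kappa2_def H_def \<theta>_def)
qed

section \<open>The condition number of the preconditioned matrix\<close>

theorem mainTheorem4:
  fixes A Q At :: "real^'n^'n"
    and p1 p4 :: "nat \<Rightarrow> real"
    and u ul p18 \<theta> :: real
  assumes p_pos: "0 < p1 CARD('n)" "0 < p4 CARD('n)"
    and spd: "sym_pos_def A"
    and roundoff: "0 < u" "u < ul"
    and At: "At = transpose Q ** A ** Q"
    and orth: "norm2 (transpose Q ** Q - mat 1) \<le> p1 CARD('n) * u"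
    and p1u: "p1 CARD('n) * u < 1"
    and off_le: "off At \<le> p4 CARD('n) * ul * frob_norm A"
    and p18: "p18 = sqrt (real CARD('n)) * p4 CARD('n) / (1 - p1 CARD('n) * u)"
    and \<theta>: "\<theta> = off At / min_diag At"
  shows "off At / min_diag At \<le> p4 CARD('n) * ul * frob_norm A / lambda_min At
    \<and> p4 CARD('n) * ul * frob_norm A / lambda_min At \<le> p18 * ul * kappa2 A
    \<and> (kappa2 A < 1 / (p18 * ul) \<longrightarrow>
         \<theta> < 1 \<and> kappa2_S At \<le> (1 + \<theta>) / (1 - \<theta>))"
proof -
  define e where "e = p1 CARD('n) * u"
  define F where "F = p4 CARD('n) * ul * frob_norm A"
  have e: "0 < 1 - e" using p1u by (simp add: e_def)
  have sym: "transpose A = A" using spd by (simp add: sym_pos_def_def)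
  have c: "0 < p4 CARD('n) * ul" using p_pos roundoff by simp
  have Q: "(1 - e) * (norm x)\<^sup>2 \<le> (norm (Q *v x))\<^sup>2" for x
    using nearly_orthogonal_norm_ge orth unfolding e_def by blast
  have "Q *v x \<noteq> 0" if "x \<noteq> 0" for x
    using Q[of x] e that by (auto simp: mult_le_0_iff)
  then have spdt: "sym_pos_def At"
    unfolding At by (rule sym_pos_def_congruence[OF spd])
  then have symt: "transpose At = At" by (simp add: sym_pos_def_def)
  have la: "0 < lambda_min A" and lt: "0 < lambda_min At"
    using lambda_min_pos spd spdt by auto
  have min: "(1 - e) * lambda_min A \<le> lambda_min At"
    unfolding At by (rule lambda_min_congruence[OF spd Q])
  have diag: "lambda_min At \<le> min_diag At"
    by (auto simp: min_diag_def lambda_min_le_diag[OF symt])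
  have first: "off At / min_diag At \<le> F / lambda_min At"
    using off_le off_nonneg[of At] lt diag unfolding F_def by (intro frac_le) auto
  have "F / lambda_min At
      \<le> p4 CARD('n) * ul * (sqrt (real CARD('n)) * lambda_max A) / ((1 - e) * lambda_min A)"
    unfolding F_def
    using c e la lambda_min_le_lambda_max[OF sym] min frob_norm_le_lambda_max[OF spd]
    by (intro frac_le mult_left_mono mult_nonneg_nonneg[OF less_imp_le[OF c]]) auto
  also have "\<dots> = p18 * ul * kappa2 A"
    by (simp add: p18 kappa2_def e_def mult_ac)
  finally have second: "F / lambda_min At \<le> p18 * ul * kappa2 A" .
  have "\<theta> < 1 \<and> kappa2_S At \<le> (1 + \<theta>) / (1 - \<theta>)" if "kappa2 A < 1 / (p18 * ul)"
  proof -
    have "0 < p18 * ul" using p_pos roundoff e by (simp add: p18 e_def)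
    then have "p18 * ul * kappa2 A < 1" using that by (simp add: field_simps)
    then have "\<theta> < 1" using first second by (simp add: \<theta>)
    then show ?thesis using kappa2_S_le[OF symt] lt diag by (simp add: \<theta>)
  qed
  then show ?thesis using first second unfolding F_def by blast
qed

end
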